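(* Let $d\ge 2$, $D=\{1,\dots,d\}$, let $E$ be the set of all edges $(i,j)$, $i\ne j$, $i,j\in D$, of the complete graph on $D$, and let $\mathcal I=\{F\subseteq E: F\text{ defines a forest on }D\}$. Then, for every GNB graph structure on $\{0\}\cup D$, the spanning tree on $D$ which defines it (the set of edges of the GNB graph having both endpoints in $D$) is a basis, i.e. a maximal independent set, of the matroid $(E,\mathcal I)$.
   Context: A matroid is a pair $(E,\mathcal I)$ with $E$ finite, $\mathcal I\subseteq 2^E$ nonempty, closed under taking subsets, and such that for $A,B\in\mathcal I$ with $|A|<|B|$ there is $e\in B\setminus A$ with $A\cup\{e\}\in\mathcal I$; members of $\mathcal I$ are called independent. The pair $(E,\mathcal I)$ in the claim is a matroid. A GNB (Generalized Naive Bayes) graph structure on $\{0\}\cup D$ is a graph built as follows. Start with a triangle on $\{0,i_1,i_2\}$, $i_1,i_2\in D$ distinct. Then repeatedly add a new vertex $i_{k+1}\in D$, connecting it to $0$ and to exactly one already present vertex of $\{i_1,\dots,i_k\}$, until all of $D$ is used. The subgraph induced on $D$ is a spanning tree of $D$ and determines the GNB structure uniquely. *)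

theory Defs
  imports Main
begin

definition matroid :: "'a set \<Rightarrow> 'a set set \<Rightarrow> bool" where
  "matroid E \<I> \<longleftrightarrow>
     finite E \<and> \<I> \<subseteq> Pow E \<and> \<I> \<noteq> {} \<and>
     (\<forall>A\<in>\<I>. \<forall>B. B \<subseteq> A \<longrightarrow> B \<in> \<I>) \<and>
     (\<forall>A\<in>\<I>. \<forall>B\<in>\<I>. card A < card B \<longrightarrow> (\<exists>e\<in>B - A. insert e A \<in> \<I>))"

definition matroid_basis :: "'a set \<Rightarrow> 'a set set \<Rightarrow> 'a set \<Rightarrow> bool" where
  "matroid_basis E \<I> B \<longleftrightarrow>
     matroid E \<I> \<and> B \<in> \<I> \<and> (\<forall>A\<in>\<I>. B \<subseteq> A \<longrightarrow> A = B)"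

(* Graphs are simple and undirected: an edge is a two-element set of vertices,
   and a graph on a known vertex set is given by its set of edges. *)

definition complete_edges :: "'v set \<Rightarrow> 'v set set" where
  "complete_edges V = {{i, j} | i j. i \<in> V \<and> j \<in> V \<and> i \<noteq> j}"

definition cycle_in :: "'v set set \<Rightarrow> 'v list \<Rightarrow> bool" where
  "cycle_in F vs \<longleftrightarrow>
     3 \<le> length vs \<and> distinct vs \<and>
     (\<forall>k<length vs. {vs ! k, vs ! (Suc k mod length vs)} \<in> F)"

definition forest_on :: "'v set \<Rightarrow> 'v set set \<Rightarrow> bool" where
  "forest_on V F \<longleftrightarrow> F \<subseteq> complete_edges V \<and> (\<nexists>vs. cycle_in F vs)"

definition connected_on :: "'v set \<Rightarrow> 'v set set \<Rightarrow> bool" where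
  "connected_on V F \<longleftrightarrow> (\<forall>u\<in>V. \<forall>v\<in>V. (u, v) \<in> {(x, y). {x, y} \<in> F}\<^sup>*)"

definition spanning_tree_on :: "'v set \<Rightarrow> 'v set set \<Rightarrow> bool" where
  "spanning_tree_on V F \<longleftrightarrow> forest_on V F \<and> connected_on V F"

(* gnb_stage D V G: after some number of construction steps, the vertices
   present are V (including 0) and the edges present are G. *)

inductive gnb_stage :: "nat set \<Rightarrow> nat set \<Rightarrow> nat set set \<Rightarrow> bool" for D :: "nat set" where
  triangle: "\<lbrakk>i \<in> D; j \<in> D; i \<noteq> j\<rbrakk>
     \<Longrightarrow> gnb_stage D {0, i, j} {{0, i}, {0, j}, {i, j}}"
| attach: "\<lbrakk>gnb_stage D V G; i \<in> D; i \<notin> V; j \<in> V - {0}\<rbrakk>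
     \<Longrightarrow> gnb_stage D (insert i V) (G \<union> {{0, i}, {j, i}})"

definition gnb_structure :: "nat set \<Rightarrow> nat set set \<Rightarrow> bool" where
  "gnb_structure D G \<longleftrightarrow> gnb_stage D ({0} \<union> D) G"

definition edges_within :: "'v set \<Rightarrow> 'v set set \<Rightarrow> 'v set set" where
  "edges_within V G = {e \<in> G. e \<subseteq> V}"

end

theory Submission
  imports Defs
begin

text \<open>
  A graph is a forest iff every edge is a bridge, so forests can be handled through the
  reachability relation of their edge sets alone. The augmentation axiom is a Steinitz exchange:
  if every edge of a forest \<open>B\<close> joins two vertices connected in \<open>A\<close>, then an edge of \<open>A - B\<close> can be
  traded for any given edge of \<open>B - A\<close> without losing connections, until \<open>B \<subseteq> A\<close>; hence
  \<open>card B \<le> card A\<close>. The edges of a GNB structure inside \<open>D\<close> grow by attaching leaves, so they form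
  a spanning tree, and a connected graph gains a cycle with every additional edge.
\<close>

section \<open>Reachability in a set of edges\<close>

abbreviation reach :: "'v set set \<Rightarrow> ('v \<times> 'v) set" where
  "reach F \<equiv> {(x, y). {x, y} \<in> F}\<^sup>*"

lemma reach_sym: "(x, y) \<in> reach F \<Longrightarrow> (y, x) \<in> reach F"
proof -
  have "sym {(x, y). {x, y} \<in> F}" by (auto simp: sym_def insert_commute)
  then show "(x, y) \<in> reach F \<Longrightarrow> (y, x) \<in> reach F"
    by (meson sym_rtrancl symD)
qed

lemma reach_mono: "F \<subseteq> G \<Longrightarrow> reach F \<subseteq> reach G"
  by (rule rtrancl_mono) auto

lemma reach_edge: "{x, y} \<in> F \<Longrightarrow> (x, y) \<in> reach F"
  by auto

text \<open>Walking back from \<open>u\<close> to one end of the connection between \<open>x\<close>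
  and \<open>y\<close>, along it, and on to \<open>v\<close> joins \<open>u\<close> to
  \<open>v\<close>. This is the counterpart of \<open>reach_insertD\<close>: if an edge between
  \<open>u\<close> and \<open>v\<close> helps to connect \<open>x\<close> and \<open>y\<close>, then
  a connection of \<open>x\<close> and \<open>y\<close> makes up for that edge.\<close>

lemma reach_cross:
  assumes "(x, y) \<in> reach F"
    and "(x, u) \<in> reach F \<and> (v, y) \<in> reach F \<or> (x, v) \<in> reach F \<and> (u, y) \<in> reach F"
  shows "(u, v) \<in> reach F"
  using assms(2)
proof
  assume "(x, u) \<in> reach F \<and> (v, y) \<in> reach F"
  then have "(u, x) \<in> reach F" "(y, v) \<in> reach F" by (simp_all add: reach_sym)
  with assms(1) show ?thesis by (meson rtrancl_trans)
next
  assume "(x, v) \<in> reach F \<and> (u, y) \<in> reach F"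
  moreover have "(y, x) \<in> reach F" using assms(1) by (rule reach_sym)
  ultimately show ?thesis by (meson rtrancl_trans)
qed

text \<open>A walk that crosses the new edge repeatedly can be shortened to cross it at most once:
  on coming back to \<open>u\<close> or \<open>v\<close>, the detour since the earlier visit is
  dropped. The last two disjuncts are the two directions of a single crossing.\<close>

lemma reach_insertD:
  assumes "(x, y) \<in> reach (insert {u, v} F)"
  shows "(x, y) \<in> reach F \<or> (x, u) \<in> reach F \<and> (v, y) \<in> reach F
    \<or> (x, v) \<in> reach F \<and> (u, y) \<in> reach F"
  using assms
proof (induction rule: rtrancl_induct)
  case base
  then show ?case by simp
next
  case (step y z)
  show ?case
  proof (cases "{y, z} \<in> F")
    case True
    then have "(y, z) \<in> reach F" by (rule reach_edge)
    with step.IH show ?thesis by (meson rtrancl_trans)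
  next
    case False
    with step.hyps have "y = u \<and> z = v \<or> y = v \<and> z = u"
      by (auto simp: doubleton_eq_iff)
    with step.IH show ?thesis by auto
  qed
qed

lemma reach_leI:
  assumes "\<And>x y. {x, y} \<in> F \<Longrightarrow> (x, y) \<in> reach G"
  shows "reach F \<subseteq> reach G"
  using assms by (intro rtrancl_subset_rtrancl) auto

lemma reach_within:
  assumes "(x, y) \<in> reach F" "F \<subseteq> complete_edges V" "x \<in> V"
  shows "y \<in> V"
  using assms(1)
proof (induction rule: rtrancl_induct)
  case (step y z)
  then show ?case using assms(2) by (auto simp: complete_edges_def doubleton_eq_iff)
qed (use assms in simp)

lemma complete_edgesE:
  assumes "e \<in> complete_edges V"
  obtains u v where "e = {u, v}" "u \<in> V" "v \<in> V" "u \<noteq> v"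
  using assms by (auto simp: complete_edges_def)

section \<open>Cycles and bridges\<close>

text \<open>The path is built backwards from \<open>v\<close>. If the vertex to be prepended already
  occurs, the suffix starting at that occurrence is taken instead.\<close>

lemma rtrancl_distinct_path:
  assumes "(u, v) \<in> r\<^sup>*"
  obtains vs where "vs \<noteq> []" "hd vs = u" "last vs = v" "distinct vs"
    "successively (\<lambda>x y. (x, y) \<in> r) vs"
proof -
  have "\<exists>vs. vs \<noteq> [] \<and> hd vs = u \<and> last vs = v \<and> distinct vs
      \<and> successively (\<lambda>x y. (x, y) \<in> r) vs"
    using assms
  proof (induction rule: converse_rtrancl_induct)
    case base
    show ?case by (rule exI[of _ "[v]"]) simp
  next
    case (step u w)
    then obtain vs where vs: "vs \<noteq> []" "hd vs = w" "last vs = v" "distinct vs"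
      "successively (\<lambda>x y. (x, y) \<in> r) vs" by blast
    show ?case
    proof (cases "u \<in> set vs")
      case True
      then obtain as bs where "vs = as @ u # bs" by (meson split_list)
      with vs have "last (u # bs) = v" "distinct (u # bs)"
        "successively (\<lambda>x y. (x, y) \<in> r) (u # bs)"
        by (auto simp: successively_append_iff)
      then show ?thesis by (intro exI[of _ "u # bs"]) simp
    next
      case False
      with vs step.hyps show ?thesis
        by (intro exI[of _ "u # vs"]) (auto simp: successively_Cons)
    qed
  qed
  with that show thesis by blast
qed

text \<open>A simple path from \<open>u\<close> to \<open>v\<close> that avoids the edge between
  them closes up with this edge to a cycle.\<close>

lemma bridges_if_acyclic:
  assumes "\<nexists>vs. cycle_in F vs" "{u, v} \<in> F" "u \<noteq> v"
  shows "(u, v) \<notin> reach (F - {{u, v}})"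
proof
  assume "(u, v) \<in> reach (F - {{u, v}})"
  then obtain vs where vs: "vs \<noteq> []" "hd vs = u" "last vs = v" "distinct vs"
    and "successively (\<lambda>x y. (x, y) \<in> {(x, y). {x, y} \<in> F - {{u, v}}}) vs"
    by (rule rtrancl_distinct_path)
  then have edges: "{vs ! k, vs ! Suc k} \<in> F - {{u, v}}" if "Suc k < length vs" for k
    using that by (auto simp: successively_conv_nth)
  have ends: "vs ! 0 = u" "vs ! (length vs - 1) = v"
    using vs by (simp_all add: hd_conv_nth last_conv_nth)
  \<comment> \<open>One vertex would force \<open>u = v\<close>, and two vertices would make the
    path the deleted edge itself.\<close>
  have "length vs \<noteq> 1" using ends assms(3) by auto
  moreover have "length vs \<noteq> 2" using edges[of 0] ends by auto
  moreover have "length vs \<noteq> 0" using vs(1) by simp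
  ultimately have len: "3 \<le> length vs" by linarith
  have "{vs ! k, vs ! (Suc k mod length vs)} \<in> F" if "k < length vs" for k
  proof (cases "Suc k < length vs")
    case True
    then show ?thesis using edges by simp
  next
    case False
    with that have "Suc k = length vs" by simp
    then have "vs ! (Suc k mod length vs) = u" "vs ! k = v"
      using ends by (metis mod_self) (metis ends(2) \<open>Suc k = length vs\<close> diff_Suc_1)
    with assms(2) show ?thesis by (simp add: insert_commute)
  qed
  with len vs(4) have "cycle_in F vs" by (simp add: cycle_in_def)
  with assms(1) show False by blast
qed

text \<open>The rest of the cycle, from \<open>vs ! 1\<close> up to the last vertex and from there
  to \<open>vs ! 0\<close>, is a detour around the first edge.\<close>

lemma cycle_edge_not_bridge:
  assumes "cycle_in F vs"
  shows "{vs ! 0, vs ! 1} \<in> F" "(vs ! 1, vs ! 0) \<in> reach (F - {{vs ! 0, vs ! 1}})"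
proof -
  let ?n = "length vs" and ?F = "F - {{vs ! 0, vs ! 1}}"
  have n: "3 \<le> ?n" "vs \<noteq> []" and dist: "distinct vs"
    and cyc: "\<And>k. k < ?n \<Longrightarrow> {vs ! k, vs ! (Suc k mod ?n)} \<in> F"
    using assms by (auto simp: cycle_in_def)
  have "0 < ?n" "Suc 0 mod ?n = 1" using n by auto
  with cyc[of 0] show "{vs ! 0, vs ! 1} \<in> F" by simp
  have path: "Suc k < ?n \<Longrightarrow> (vs ! 1, vs ! Suc k) \<in> reach ?F" for k
  proof (induction k)
    case (Suc k)
    then have "{vs ! Suc k, vs ! Suc (Suc k)} \<in> F" using cyc[of "Suc k"] by simp
    \<comment> \<open>A vertex that is neither \<open>vs ! 0\<close> nor \<open>vs ! 1\<close> keeps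
      this edge distinct from the deleted one.\<close>
    moreover have "vs ! Suc (Suc k) \<noteq> vs ! 0" "vs ! Suc (Suc k) \<noteq> vs ! 1"
      using nth_eq_iff_index_eq[OF dist, of "Suc (Suc k)" 0]
        nth_eq_iff_index_eq[OF dist, of "Suc (Suc k)" 1] Suc.prems n by auto
    ultimately have "{vs ! Suc k, vs ! Suc (Suc k)} \<in> ?F"
      by (auto simp: doubleton_eq_iff)
    then have "(vs ! Suc k, vs ! Suc (Suc k)) \<in> reach ?F" by (rule reach_edge)
    with Suc show ?case by (meson Suc_lessD rtrancl_trans)
  qed simp
  \<comment> \<open>\<open>Suc m\<close> is the index of the last vertex;
    \<open>m \<noteq> 0\<close> separates that vertex from \<open>vs ! 1\<close>, so the closing
    edge is not the deleted one.\<close>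
  obtain m where m: "?n = Suc (Suc m)" "m \<noteq> 0"
    using n by (metis One_nat_def Suc_le_D not_less_eq_eq numeral_3_eq_3 zero_le)
  have "{vs ! Suc m, vs ! 0} \<in> F" using cyc[of "Suc m"] m by simp
  moreover have "vs ! Suc m \<noteq> vs ! 0" "vs ! Suc m \<noteq> vs ! 1"
    using dist m by (simp_all add: nth_eq_iff_index_eq)
  ultimately have "{vs ! Suc m, vs ! 0} \<in> ?F" by (auto simp: doubleton_eq_iff)
  then have "(vs ! Suc m, vs ! 0) \<in> reach ?F" by (rule reach_edge)
  moreover have "(vs ! 1, vs ! Suc m) \<in> reach ?F" using path[of m] m(1) by simp
  ultimately show "(vs ! 1, vs ! 0) \<in> reach ?F" by (rule rtrancl_trans[rotated])
qed

lemma forest_on_iff_bridges: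
  "forest_on V F \<longleftrightarrow> F \<subseteq> complete_edges V \<and>
    (\<forall>u v. {u, v} \<in> F \<longrightarrow> (u, v) \<notin> reach (F - {{u, v}}))"
  (is "_ \<longleftrightarrow> _ \<and> ?bridges")
proof (intro iffI conjI)
  assume F: "forest_on V F"
  then show sub: "F \<subseteq> complete_edges V" by (simp add: forest_on_def)
  show ?bridges
  proof (intro allI impI)
    fix u v assume uv: "{u, v} \<in> F"
    with sub have "u \<noteq> v" by (auto simp: complete_edges_def doubleton_eq_iff)
    with F uv show "(u, v) \<notin> reach (F - {{u, v}})"
      by (intro bridges_if_acyclic) (auto simp: forest_on_def)
  qed
next
  assume F: "F \<subseteq> complete_edges V \<and> ?bridges"
  have "\<not> cycle_in F vs" for vs
  proof
    assume "cycle_in F vs"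
    note cyc = cycle_edge_not_bridge[OF this]
    from reach_sym[OF cyc(2)] cyc(1) F show False by blast
  qed
  with F show "forest_on V F" by (simp add: forest_on_def)
qed

lemma forest_on_subset: "forest_on V F \<Longrightarrow> G \<subseteq> F \<Longrightarrow> forest_on V G"
  unfolding forest_on_def cycle_in_def by blast

lemma forest_on_mono: "forest_on V F \<Longrightarrow> V \<subseteq> W \<Longrightarrow> forest_on W F"
  unfolding forest_on_def complete_edges_def by blast

lemma forest_on_empty: "forest_on V {}"
  by (simp add: forest_on_iff_bridges)

text \<open>The new edge is a bridge because its ends are not connected in \<open>F\<close>. If an
  old edge stopped being a bridge, its detour would cross the new edge, and the detour's two
  remaining pieces together with the old edge would connect \<open>u\<close> and \<open>v\<close>
  inside \<open>F\<close>.\<close>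

lemma forest_on_insert:
  assumes F: "forest_on V F" and uv: "u \<in> V" "v \<in> V" and sep: "(u, v) \<notin> reach F"
  shows "forest_on V (insert {u, v} F)"
  unfolding forest_on_iff_bridges
proof (intro conjI allI impI)
  have "u \<noteq> v" using sep by auto
  with F uv show "insert {u, v} F \<subseteq> complete_edges V"
    by (auto simp: forest_on_def complete_edges_def)
next
  fix x y assume xy: "{x, y} \<in> insert {u, v} F"
  show "(x, y) \<notin> reach (insert {u, v} F - {{x, y}})"
  proof
    assume conn: "(x, y) \<in> reach (insert {u, v} F - {{x, y}})"
    show False
    proof (cases "{x, y} = {u, v}")
      case True
      then have "insert {u, v} F - {{x, y}} \<subseteq> F" by auto
      with conn have "(x, y) \<in> reach F" using reach_mono by blast
      with True sep show False by (auto simp: doubleton_eq_iff dest: reach_sym)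
    next
      case False
      let ?F = "F - {{x, y}}"
      have xyF: "{x, y} \<in> F" using xy False by auto
      with F have "(x, y) \<notin> reach ?F" by (simp add: forest_on_iff_bridges)
      moreover have "insert {u, v} F - {{x, y}} = insert {u, v} ?F" using False by auto
      ultimately have "(x, u) \<in> reach ?F \<and> (v, y) \<in> reach ?F \<or>
          (x, v) \<in> reach ?F \<and> (u, y) \<in> reach ?F"
        using reach_insertD[of x y u v ?F] conn by auto
      moreover have "reach ?F \<subseteq> reach F" by (rule reach_mono) auto
      ultimately have "(x, u) \<in> reach F \<and> (v, y) \<in> reach F \<or>
          (x, v) \<in> reach F \<and> (u, y) \<in> reach F"
        by blast
      then have "(u, v) \<in> reach F" by (rule reach_cross[OF reach_edge[OF xyF]])
      with sep show False ..
    qed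
  qed
qed

section \<open>Edge exchange and the matroid axioms\<close>

text \<open>When the edges of \<open>C\<close> are added to \<open>A\<close> one at a time, some
  edge \<open>f\<close> is the first to connect \<open>u\<close> and \<open>v\<close>;
  \<open>A'\<close> collects what was present just before.\<close>

lemma critical_edge:
  assumes "finite C" "(u, v) \<notin> reach A" "(u, v) \<in> reach (A \<union> C)"
  obtains A' f where "A \<subseteq> A'" "A' \<subseteq> A \<union> C" "f \<in> C" "f \<notin> A'"
    "(u, v) \<notin> reach A'" "(u, v) \<in> reach (insert f A')"
proof -
  have "\<exists>A' f. A \<subseteq> A' \<and> A' \<subseteq> A \<union> C \<and> f \<in> C \<and> f \<notin> A' \<and>
      (u, v) \<notin> reach A' \<and> (u, v) \<in> reach (insert f A')"
    using assms
  proof (induction C rule: finite_induct)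
    case (insert f C)
    show ?case
    proof (cases "(u, v) \<in> reach (A \<union> C)")
      case True
      with insert.IH insert.prems show ?thesis by blast
    next
      case False
      with insert.prems have "f \<notin> A \<union> C" by (metis Un_insert_right insert_absorb)
      with False insert.prems show ?thesis
        by (intro exI[of _ "A \<union> C"] exI[of _ f]) auto
    qed
  qed simp
  with that show thesis by blast
qed

lemma forest_card_le:
  assumes "finite A" "A \<subseteq> complete_edges V" "forest_on V B" "finite B" "reach B \<subseteq> reach A"
  shows "card B \<le> card A"
  using assms
proof (induction "card (B - A)" arbitrary: A rule: less_induct)
  case less
  note A = less.prems(1,2) and B = less.prems(3,4) and span = less.prems(5)
  have BV: "B \<subseteq> complete_edges V" using B(1) by (simp add: forest_on_def)
  show ?case
  proof (cases "B \<subseteq> A")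
    case True
    with A show ?thesis by (simp add: card_mono)
  next
    case False
    then obtain e where e: "e \<in> B" "e \<notin> A" by blast
    with BV obtain u v where uv: "e = {u, v}" by (blast elim: complete_edgesE)
    have "(u, v) \<notin> reach (B - {e})"
      using B(1) e(1) uv by (simp add: forest_on_iff_bridges)
    moreover have "A \<inter> B \<subseteq> B - {e}" using e by blast
    ultimately have 1: "(u, v) \<notin> reach (A \<inter> B)" using reach_mono by blast
    have "(u, v) \<in> reach A" using span reach_edge e(1) uv by blast
    \<comment> \<open>With \<open>A\<close> split this way, the critical edge is found in
      \<open>A - B\<close>, so giving it up costs no edge of \<open>B\<close>.\<close>
    then have "(u, v) \<in> reach (A \<inter> B \<union> (A - B))" by (simp add: Un_commute Un_Diff_Int)
    with 1 obtain A' f where A': "A' \<subseteq> A \<inter> B \<union> (A - B)" "f \<in> A - B" "f \<notin> A'"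
      "(u, v) \<notin> reach A'" "(u, v) \<in> reach (insert f A')"
      by (rule critical_edge[OF finite_Diff[OF A(1)]]) blast
    obtain x y where xy: "f = {x, y}" using A'(2) A(2) by (blast elim: complete_edgesE)
    \<comment> \<open>The exchange: \<open>e\<close> enters and \<open>f\<close> leaves. The size
      stays the same, while \<open>B - A2\<close> loses \<open>e\<close> and gains nothing.\<close>
    define A2 where "A2 = insert e (A - {f})"
    have "A' \<subseteq> A2" "{u, v} \<in> A2" using A' by (auto simp: A2_def uv)
    then have A'2: "reach A' \<subseteq> reach A2" and uv2: "(u, v) \<in> reach A2"
      using reach_mono reach_edge by blast+
    \<comment> \<open>By criticality, the connection of \<open>u\<close> and \<open>v\<close> runs
      through \<open>f\<close>. Its two pieces around \<open>f\<close>, joined by \<open>e\<close>,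
      lead from one end of \<open>f\<close> to the other without using \<open>f\<close>.\<close>
    have "(u, x) \<in> reach A' \<and> (y, v) \<in> reach A' \<or> (u, y) \<in> reach A' \<and> (x, v) \<in> reach A'"
      using reach_insertD[of u v x y A'] A'(4,5) xy by blast
    then have "(u, x) \<in> reach A2 \<and> (y, v) \<in> reach A2 \<or> (u, y) \<in> reach A2 \<and> (x, v) \<in> reach A2"
      using A'2 by blast
    then have xy2: "(x, y) \<in> reach A2" by (rule reach_cross[OF uv2])
    have "reach A \<subseteq> reach A2"
    proof (rule reach_leI)
      fix a b assume ab: "{a, b} \<in> A"
      show "(a, b) \<in> reach A2"
      proof (cases "{a, b} = f")
        case True
        with xy xy2 show ?thesis by (auto simp: doubleton_eq_iff dest: reach_sym)
      next
        case False
        with ab show ?thesis by (intro reach_edge) (simp add: A2_def)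
      qed
    qed
    with span have "reach B \<subseteq> reach A2" by blast
    moreover have "card (B - A2) < card (B - A)"
      using e A'(2) B(2) by (intro psubset_card_mono) (auto simp: A2_def)
    moreover have "finite A2" "A2 \<subseteq> complete_edges V"
      using A BV e by (auto simp: A2_def)
    ultimately have "card B \<le> card A2" using less.hyps B by blast
    also have "card A2 = card A"
      using A(1) A'(2) e(2) card_Suc_Diff1[of A f] by (simp add: A2_def del: card_Diff_insert)
    finally show ?thesis .
  qed
qed

lemma finite_complete_edges: "finite V \<Longrightarrow> finite (complete_edges V)"
  by (rule finite_subset[of _ "Pow V"]) (auto simp: complete_edges_def)

lemma graphic_matroid:
  assumes "finite V"
  shows "matroid (complete_edges V) {F. forest_on V F}"
  unfolding matroid_def mem_Collect_eq
proof (intro conjI subsetI CollectI ballI allI impI)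
  show "finite (complete_edges V)" using assms by (rule finite_complete_edges)
  show "{F. forest_on V F} \<noteq> {}" using forest_on_empty by blast
  show "A \<in> Pow (complete_edges V)" if "A \<in> {F. forest_on V F}" for A
    using that by (simp add: forest_on_def)
  show "forest_on V G" if "F \<in> {F. forest_on V F}" "G \<subseteq> F" for F G
    using that by (auto intro: forest_on_subset)
  fix A B assume "A \<in> {F. forest_on V F}" "B \<in> {F. forest_on V F}" and card: "card A < card B"
  then have A: "forest_on V A" and B: "forest_on V B" by auto
  then have AV: "A \<subseteq> complete_edges V" and BV: "B \<subseteq> complete_edges V"
    by (auto simp: forest_on_def)
  then have "finite A" "finite B"
    using finite_complete_edges[OF assms] by (auto intro: finite_subset)
  \<comment> \<open>The cardinality bound is used in contrapositive form: some edge of the larger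
    forest joins two components of \<open>A\<close>, and that edge augments
    \<open>A\<close>.\<close>
  with AV B card have "\<not> reach B \<subseteq> reach A" using forest_card_le[of A V B] by auto
  then obtain u v where uv: "{u, v} \<in> B" "(u, v) \<notin> reach A" using reach_leI[of B A] by blast
  then have "{u, v} \<notin> A" using reach_edge by blast
  moreover have "u \<in> V" "v \<in> V" using uv(1) BV by (auto simp: complete_edges_def doubleton_eq_iff)
  ultimately show "\<exists>e\<in>B - A. forest_on V (insert e A)"
    using forest_on_insert[OF A] uv by blast
qed

section \<open>Spanning trees and GNB structures\<close>

text \<open>An additional edge \<open>e\<close> of \<open>F\<close> would have ends already
  connected by \<open>T\<close>, hence by \<open>F - {e}\<close>, so it would not be a bridge of
  \<open>F\<close>.\<close>

lemma spanning_tree_maximal: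
  assumes "spanning_tree_on V T" "forest_on V F" "T \<subseteq> F"
  shows "F = T"
proof (rule ccontr)
  assume "F \<noteq> T"
  then obtain e where e: "e \<in> F" "e \<notin> T" using assms(3) by blast
  have "F \<subseteq> complete_edges V" using assms(2) by (simp add: forest_on_def)
  with e obtain u v where uv: "e = {u, v}" "u \<in> V" "v \<in> V" by (blast elim: complete_edgesE)
  with assms(1) have "(u, v) \<in> reach T" by (simp add: spanning_tree_on_def connected_on_def)
  moreover have "T \<subseteq> F - {e}" using assms(3) e by blast
  ultimately have "(u, v) \<in> reach (F - {e})" using reach_mono by blast
  with assms(2) e uv show False by (simp add: forest_on_iff_bridges)
qed

text \<open>No edge of \<open>T\<close> touches \<open>i\<close>, so the new edge joins vertices not
  connected in \<open>T\<close> and keeps the forest. Every vertex reaches \<open>j\<close>, so any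
  two are connected through \<open>j\<close>.\<close>

lemma spanning_tree_attach_leaf:
  assumes T: "spanning_tree_on V T" and j: "j \<in> V" and i: "i \<notin> V"
  shows "spanning_tree_on (insert i V) (insert {j, i} T)"
proof -
  let ?T = "insert {j, i} T"
  have TV: "T \<subseteq> complete_edges V" and F: "forest_on V T"
    using T by (auto simp: spanning_tree_on_def forest_on_def)
  have "(j, i) \<notin> reach T" using reach_within[OF _ TV j] i by blast
  moreover have "forest_on (insert i V) T" using F by (rule forest_on_mono) blast
  ultimately have "forest_on (insert i V) ?T" using j by (intro forest_on_insert) auto
  moreover have "connected_on (insert i V) ?T"
  proof -
    have "reach T \<subseteq> reach ?T" by (rule reach_mono) blast
    moreover have "(x, j) \<in> reach T" if "x \<in> V" for x
      using T j that by (simp add: spanning_tree_on_def connected_on_def)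
    moreover have "(i, j) \<in> reach ?T" by (rule reach_edge) (simp add: insert_commute)
    ultimately have to_j: "(x, j) \<in> reach ?T" if "x \<in> insert i V" for x
      using that by blast
    show ?thesis
      unfolding connected_on_def
    proof (intro ballI)
      fix x y assume "x \<in> insert i V" "y \<in> insert i V"
      then have "(x, j) \<in> reach ?T" "(j, y) \<in> reach ?T"
        by (blast intro: to_j reach_sym)+
      then show "(x, y) \<in> reach ?T" by (rule rtrancl_trans)
    qed
  qed
  ultimately show ?thesis by (simp add: spanning_tree_on_def)
qed

lemma spanning_tree_singleton: "spanning_tree_on {i} {}"
  by (simp add: spanning_tree_on_def connected_on_def forest_on_empty)

text \<open>Restricting to \<open>D\<close> discards the edges at \<open>0\<close>, so each
  construction step contributes exactly one leaf edge. The bound on \<open>V\<close> is carried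
  along to place the attachment vertex \<open>j\<close> in \<open>D\<close>, so that its edge
  survives the restriction.\<close>

lemma gnb_stage_spanning_tree:
  assumes "gnb_stage D V G" "0 \<notin> D"
  shows "V \<subseteq> insert 0 D \<and> spanning_tree_on (V - {0}) (edges_within D G)"
  using assms
proof (induction rule: gnb_stage.induct)
  case (triangle i j)
  have "edges_within D {{0, i}, {0, j}, {i, j}} = {{i, j}}"
    using triangle by (auto simp: edges_within_def)
  \<comment> \<open>The order \<open>{j, i}\<close> presents the initial edge as the leaf
    \<open>j\<close> attached to the one-vertex tree on \<open>i\<close>.\<close>
  moreover have "{0, i, j} - {0} = {j, i}" using triangle by auto
  ultimately show ?case
    using triangle spanning_tree_attach_leaf[OF spanning_tree_singleton, of i i j] by auto
next
  case (attach V G i j)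
  then have IH: "V \<subseteq> insert 0 D" "spanning_tree_on (V - {0}) (edges_within D G)" by auto
  have "j \<in> D" "i \<noteq> 0" using attach IH by (auto intro: ccontr)
  then have "edges_within D (G \<union> {{0, i}, {j, i}}) = insert {j, i} (edges_within D G)"
    using attach by (auto simp: edges_within_def)
  moreover have "insert i V - {0} = insert i (V - {0})" using \<open>i \<noteq> 0\<close> by auto
  ultimately show ?case
    using attach IH spanning_tree_attach_leaf[OF IH(2), of j i] by auto
qed

theorem theorem18:
  fixes d :: nat and D :: "nat set" and E :: "nat set set" and \<I> :: "nat set set set"
  assumes "d \<ge> 2"
    and "D = {1..d}"
    and "E = complete_edges D"
    and "\<I> = {F. F \<subseteq> E \<and> forest_on D F}"
  shows "matroid E \<I> \<and>
    (\<forall>G. gnb_structure D G \<longrightarrow>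
       spanning_tree_on D (edges_within D G) \<and> matroid_basis E \<I> (edges_within D G))"
proof -
  have I: "\<I> = {F. forest_on D F}" using assms by (auto simp: forest_on_def)
  have matroid: "matroid E \<I>" using graphic_matroid[of D] assms(2,3) I by simp
  have "spanning_tree_on D (edges_within D G) \<and> matroid_basis E \<I> (edges_within D G)"
    if "gnb_structure D G" for G
  proof -
    have "0 \<notin> D" using assms(2) by simp
    \<comment> \<open>At the final stage the vertex set is \<open>{0} \<union> D\<close>, and
      removing \<open>0\<close> leaves exactly \<open>D\<close>.\<close>
    with that gnb_stage_spanning_tree[of D "{0} \<union> D" G]
    have T: "spanning_tree_on D (edges_within D G)" by (simp add: gnb_structure_def)
    then have "matroid_basis E \<I> (edges_within D G)"
      using matroid spanning_tree_maximal[OF T]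
      by (auto simp: matroid_basis_def I spanning_tree_on_def)
    with T show ?thesis by blast
  qed
  with matroid show ?thesis by blast
qed

end
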